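(* Let $G$ be a group with neutral element $e$. If $\mathcal{R} = \bigoplus_{g\in G} \mathcal{R}_g$ is a strongly $G$-graded ring, then $$I\cap C_{\mathcal{R}}(Z(\mathcal{R}_e)) \neq\{0\}$$ for each nonzero ideal $I$ in $\mathcal{R}$.
   Context: All rings are associative and unital (not necessarily commutative); $G$ is an arbitrary group. A ring $\mathcal{R}$ is $G$-graded if $\mathcal{R}=\bigoplus_{g\in G}\mathcal{R}_g$ for additive subgroups $\mathcal{R}_g$ with $\mathcal{R}_g\mathcal{R}_h\subseteq \mathcal{R}_{gh}$ for all $g,h\in G$; it is strongly $G$-graded if moreover $\mathcal{R}_g\mathcal{R}_h=\mathcal{R}_{gh}$ for all $g,h\in G$, where $\mathcal{R}_g\mathcal{R}_h$ is the set of all finite sums of products $r_gr_h$ with $r_g\in\mathcal{R}_g$, $r_h\in\mathcal{R}_h$. $Z(\mathcal{R}_e)$ is the center of the neutral component subring $\mathcal{R}_e$. For a subset $S\subseteq \mathcal{R}$, the commutant $C_{\mathcal{R}}(S)$ is the set of elements of $\mathcal{R}$ commuting with every element of $S$. Ideals are two-sided. *)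

theory Defs
  imports "HOL-Algebra.Algebra"
begin

text \<open>
  The condition \<open>direct_sum\<close> says that \<open>R\<close> is the internal direct sum of the \<open>A g\<close>: each element
  of \<open>R\<close> is \<open>\<Oplus> f g\<close> for a unique finitely supported family \<open>f\<close> with \<open>f g \<in> A g\<close>.  The families
  are extensional, since otherwise their values outside \<open>carrier G\<close> would break uniqueness, and
  the sum runs over the support, since \<open>finsum\<close> over an infinite index set is \<open>\<zero>\<close> by convention.
\<close>

locale graded_ring = G?: group G + R?: ring R
  for G :: "('g, 'a) monoid_scheme" and R :: "('r, 'b) ring_scheme" (structure)
    and A :: "'g \<Rightarrow> 'r set" +
  assumes component_subgroup: "g \<in> carrier G \<Longrightarrow> additive_subgroup (A g) R"
    and direct_sum: "x \<in> carrier R \<Longrightarrow>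
      \<exists>!f. f \<in> (\<Pi>\<^sub>E g\<in>carrier G. A g) \<and> finite {g \<in> carrier G. f g \<noteq> \<zero>} \<and>
           x = (\<Oplus>g\<in>{g \<in> carrier G. f g \<noteq> \<zero>}. f g)"
    and component_mult: "\<lbrakk>g \<in> carrier G; h \<in> carrier G; r \<in> A g; s \<in> A h\<rbrakk> \<Longrightarrow>
      r \<otimes> s \<in> A (g \<otimes>\<^bsub>G\<^esub> h)"

text \<open>
  Despite its name, \<open>ideal_prod R S T\<close> makes sense for arbitrary subsets: it is the set of all
  nonempty finite sums of products \<open>s \<otimes> t\<close>.  For additive subgroups the empty sum
  \<open>\<zero> = \<zero> \<otimes> \<zero>\<close> is among them.
\<close>

locale strongly_graded_ring = graded_ring +
  assumes component_prod: "\<lbrakk>g \<in> carrier G; h \<in> carrier G\<rbrakk> \<Longrightarrow>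
      ideal_prod R (A g) (A h) = A (g \<otimes>\<^bsub>G\<^esub> h)"

definition commutant :: "('r, 'b) ring_scheme \<Rightarrow> 'r set \<Rightarrow> 'r set" where
  "commutant R S = {x \<in> carrier R. \<forall>s\<in>S. x \<otimes>\<^bsub>R\<^esub> s = s \<otimes>\<^bsub>R\<^esub> x}"

definition ring_center :: "('r, 'b) ring_scheme \<Rightarrow> 'r set" where
  "ring_center R = commutant R (carrier R)"

end

theory Submission
  imports Defs
begin

text \<open>
  The proof is a minimal-support argument.  Among the nonzero elements of the ideal \<open>I\<close> take one
  whose homogeneous components vanish at all but as few degrees as possible.  Right multiplication
  by a homogeneous element of degree \<open>g\<inverse>\<close> carries a support into its translate by \<open>g\<inverse>\<close>, so it
  does not increase the number of nonzero components, and strong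
  grading guarantees that some such multiplication does not kill a given nonzero component of
  degree \<open>g\<close> (\<open>strongly_graded_ring.homogeneous_multiplier\<close>).  Hence a minimal element \<open>y\<close> can be
  chosen with nonzero neutral component \<open>y\<^sub>e\<close>.

  If \<open>z\<close> lies in the center of the neutral component ring, then \<open>w = z y - y z\<close> is again in \<open>I\<close>, and
  its components are \<open>z y\<^sub>g - y\<^sub>g z\<close>.  So the support of \<open>w\<close> is contained in that of \<open>y\<close>, and
  it misses the neutral degree, because \<open>z\<close> commutes with \<open>y\<^sub>e\<close>.  By minimality \<open>w = 0\<close>; thus \<open>y\<close>
  commutes with every such \<open>z\<close>.
\<close>

section \<open>Homogeneous components in a graded ring\<close>

context graded_ring
begin

definition component :: "'r \<Rightarrow> 'g \<Rightarrow> 'r" where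
  "component x = (THE f. f \<in> (\<Pi>\<^sub>E g\<in>carrier G. A g) \<and> finite {g \<in> carrier G. f g \<noteq> \<zero>} \<and>
     x = (\<Oplus>g\<in>{g \<in> carrier G. f g \<noteq> \<zero>}. f g))"

definition support :: "'r \<Rightarrow> 'g set" where
  "support x = {g \<in> carrier G. component x g \<noteq> \<zero>}"

lemma homogeneous_closed: "\<lbrakk>g \<in> carrier G; r \<in> A g\<rbrakk> \<Longrightarrow> r \<in> carrier R"
  by (rule additive_subgroup.a_Hcarr[OF component_subgroup])

lemma zero_homogeneous: "g \<in> carrier G \<Longrightarrow> \<zero> \<in> A g"
  by (rule additive_subgroup.zero_closed[OF component_subgroup])

lemma component_props:
  assumes "x \<in> carrier R"
  shows "component x \<in> (\<Pi>\<^sub>E g\<in>carrier G. A g) \<and> finite (support x) \<and>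
    x = (\<Oplus>g\<in>support x. component x g)"
  using theI'[OF direct_sum[OF assms]] unfolding component_def[symmetric] support_def .

lemma component_in: "\<lbrakk>x \<in> carrier R; g \<in> carrier G\<rbrakk> \<Longrightarrow> component x g \<in> A g"
  using component_props by blast

lemma component_closed: "\<lbrakk>x \<in> carrier R; g \<in> carrier G\<rbrakk> \<Longrightarrow> component x g \<in> carrier R"
  using component_in homogeneous_closed by blast

lemma finite_support: "x \<in> carrier R \<Longrightarrow> finite (support x)"
  using component_props by blast

lemma support_subset: "support x \<subseteq> carrier G"
  by (auto simp: support_def)

lemma sum_components:
  assumes x: "x \<in> carrier R" and S: "finite S" "support x \<subseteq> S" "S \<subseteq> carrier G"
  shows "(\<Oplus>g\<in>S. component x g) = x"
proof -
  have "(\<Oplus>g\<in>support x. component x g) = (\<Oplus>g\<in>S. component x g)"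
    using S component_closed[OF x]
    by (intro R.add.finprod_mono_neutral_cong_left) (auto simp: support_def)
  then show ?thesis
    using component_props[OF x] by metis
qed

text \<open>
  All computations of components go through this lemma: it lets the uniqueness in the direct sum
  decomposition be applied to any finite sum of homogeneous terms of distinct degrees, with no need
  to know which of the terms vanish.
\<close>

lemma component_finsum:
  assumes S: "finite S" "S \<subseteq> carrier G" and f: "\<And>g. g \<in> S \<Longrightarrow> f g \<in> A g"
    and g: "g \<in> carrier G"
  shows "component (\<Oplus>h\<in>S. f h) g = (if g \<in> S then f g else \<zero>)"
proof -
  define F where "F = (\<lambda>g. if g \<in> carrier G then if g \<in> S then f g else \<zero> else undefined)"
  define T where "T = {g \<in> carrier G. F g \<noteq> \<zero>}"
  let ?x = "\<Oplus>h\<in>S. f h"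
  have fc: "\<And>g. g \<in> S \<Longrightarrow> f g \<in> carrier R"
    using f S homogeneous_closed by blast
  then have x: "?x \<in> carrier R"
    by (intro R.finsum_closed) auto
  have F_S: "\<And>g. g \<in> S \<Longrightarrow> F g = f g"
    using S by (auto simp: F_def)
  have TS: "T \<subseteq> S"
    by (auto simp: T_def F_def)
  have "(\<Oplus>h\<in>T. F h) = ?x"
  proof (rule R.add.finprod_mono_neutral_cong_left[OF S(1) TS])
    show "\<And>i. i \<in> S - T \<Longrightarrow> f i = \<zero>"
      using S F_S by (auto simp: T_def)
  qed (use F_S fc TS in auto)
  moreover have "F \<in> (\<Pi>\<^sub>E g\<in>carrier G. A g)"
    using f zero_homogeneous by (auto simp: F_def)
  moreover have "finite T"
    using TS S(1) by (rule finite_subset)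
  ultimately have "component ?x = F"
    unfolding component_def T_def by (intro the1_equality[OF direct_sum[OF x]] conjI) simp_all
  then show ?thesis
    using F_S g by (simp add: F_def)
qed

lemma component_zero: "g \<in> carrier G \<Longrightarrow> component \<zero> g = \<zero>"
  using component_finsum[of "{}" "\<lambda>_. \<zero>" g] by simp

lemma component_homogeneous: "\<lbrakk>g \<in> carrier G; r \<in> A g\<rbrakk> \<Longrightarrow> component r g = r"
  using component_finsum[of "{g}" "\<lambda>_. r" g] homogeneous_closed by auto

lemma support_nonempty:
  assumes "x \<in> carrier R" "x \<noteq> \<zero>"
  shows "support x \<noteq> {}"
  using sum_components[OF assms(1), of "{}"] assms(2) by auto

lemma component_add:
  assumes x: "x \<in> carrier R" and y: "y \<in> carrier R" and g: "g \<in> carrier G"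
  shows "component (x \<oplus> y) g = component x g \<oplus> component y g"
proof -
  let ?S = "insert g (support x \<union> support y)"
  have S: "finite ?S" "?S \<subseteq> carrier G"
    using finite_support x y g support_subset by auto
  have "x \<oplus> y = (\<Oplus>h\<in>?S. component x h) \<oplus> (\<Oplus>h\<in>?S. component y h)"
    using sum_components[OF x S(1) _ S(2)] sum_components[OF y S(1) _ S(2)]
    by (metis Un_upper1 Un_upper2 subset_insertI2)
  also have "\<dots> = (\<Oplus>h\<in>?S. component x h \<oplus> component y h)"
    using S component_closed[OF x] component_closed[OF y]
    by (intro R.finsum_addf[symmetric]) auto
  finally have eq: "x \<oplus> y = (\<Oplus>h\<in>?S. component x h \<oplus> component y h)" .
  have "component x h \<oplus> component y h \<in> A h" if "h \<in> ?S" for h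
    using that S(2) component_in x y
    by (auto intro!: additive_subgroup.a_closed[OF component_subgroup])
  then show ?thesis
    unfolding eq using component_finsum[OF S _ g] by simp
qed

lemma component_diff_eq_zero:
  assumes x: "x \<in> carrier R" and y: "y \<in> carrier R" and g: "g \<in> carrier G"
    and eq: "component x g = component y g"
  shows "component (x \<ominus> y) g = \<zero>"
proof -
  have "component ((x \<ominus> y) \<oplus> y) g = component (x \<ominus> y) g \<oplus> component y g"
    using x y g by (intro component_add) auto
  moreover have "(x \<ominus> y) \<oplus> y = x"
    using x y by (simp add: R.minus_eq R.add.m_assoc R.l_neg)
  ultimately show ?thesis
    using eq x y g component_closed R.add.l_cancel_one' R.add.r_cancel_one'
    by (metis R.minus_closed)
qed

text \<open>
  Multiplying by a homogeneous element of degree \<open>h\<close> translates degrees by \<open>h\<close>, which is injective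
  on \<open>G\<close>; the terms of the product therefore keep distinct degrees, and reindexing by the
  translation puts them in the form required by \<open>component_finsum\<close>.
\<close>

lemma component_mult_left:
  assumes h: "h \<in> carrier G" and r: "r \<in> A h" and x: "x \<in> carrier R" and g: "g \<in> carrier G"
  shows "component (r \<otimes> x) g = r \<otimes> component x (inv\<^bsub>G\<^esub> h \<otimes>\<^bsub>G\<^esub> g)"
proof -
  \<comment> \<open>The degree that contributes to \<open>g\<close> is added to the support so that it is always summed over.\<close>
  let ?k = "inv\<^bsub>G\<^esub> h \<otimes>\<^bsub>G\<^esub> g"
  let ?S = "insert ?k (support x)"
  let ?t = "\<lambda>g. h \<otimes>\<^bsub>G\<^esub> g"
  let ?f = "\<lambda>g. r \<otimes> component x (inv\<^bsub>G\<^esub> h \<otimes>\<^bsub>G\<^esub> g)"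
  have rc: "r \<in> carrier R"
    using h r homogeneous_closed by blast
  have S: "finite ?S" "?S \<subseteq> carrier G"
    using finite_support[OF x] support_subset h g by auto
  have cancel: "inv\<^bsub>G\<^esub> h \<otimes>\<^bsub>G\<^esub> (h \<otimes>\<^bsub>G\<^esub> k) = k" "h \<otimes>\<^bsub>G\<^esub> (inv\<^bsub>G\<^esub> h \<otimes>\<^bsub>G\<^esub> k) = k"
    if "k \<in> carrier G" for k
    using that h by (simp_all add: G.m_assoc[symmetric])
  have f: "?f k \<in> A k" if "k \<in> carrier G" for k
    using component_mult[OF h _ r component_in[OF x], of "inv\<^bsub>G\<^esub> h \<otimes>\<^bsub>G\<^esub> k"] h that cancel(2)[OF that]
    by auto
  have f_closed: "?f k \<in> carrier R" if "k \<in> carrier G" for k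
    using homogeneous_closed[OF that f[OF that]] .
  have "r \<otimes> x = r \<otimes> (\<Oplus>k\<in>?S. component x k)"
    using sum_components[OF x S(1) _ S(2)] by (metis subset_insertI)
  also have "\<dots> = (\<Oplus>k\<in>?S. r \<otimes> component x k)"
    using S rc component_closed[OF x] by (intro R.finsum_rdistr) auto
  also have "\<dots> = (\<Oplus>k\<in>?S. ?f (?t k))"
    using S rc component_closed[OF x] cancel(1) by (intro R.finsum_cong') auto
  also have "\<dots> = (\<Oplus>k\<in>?t ` ?S. ?f k)"
    using S f_closed h
    by (intro R.add.finprod_reindex[symmetric] inj_on_subset[OF G.inj_on_cmult]) auto
  finally have "r \<otimes> x = (\<Oplus>k\<in>?t ` ?S. ?f k)" .
  moreover have "g \<in> ?t ` ?S"
    using cancel(2)[OF g] by force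
  moreover have "finite (?t ` ?S)" "?t ` ?S \<subseteq> carrier G"
    using S h by auto
  ultimately show ?thesis
    using component_finsum[of "?t ` ?S" ?f g] f g by auto
qed

lemma component_mult_right:
  assumes h: "h \<in> carrier G" and r: "r \<in> A h" and x: "x \<in> carrier R" and g: "g \<in> carrier G"
  shows "component (x \<otimes> r) g = component x (g \<otimes>\<^bsub>G\<^esub> inv\<^bsub>G\<^esub> h) \<otimes> r"
proof -
  let ?k = "g \<otimes>\<^bsub>G\<^esub> inv\<^bsub>G\<^esub> h"
  let ?S = "insert ?k (support x)"
  let ?t = "\<lambda>g. g \<otimes>\<^bsub>G\<^esub> h"
  let ?f = "\<lambda>g. component x (g \<otimes>\<^bsub>G\<^esub> inv\<^bsub>G\<^esub> h) \<otimes> r"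
  have rc: "r \<in> carrier R"
    using h r homogeneous_closed by blast
  have S: "finite ?S" "?S \<subseteq> carrier G"
    using finite_support[OF x] support_subset h g by auto
  have cancel: "(k \<otimes>\<^bsub>G\<^esub> h) \<otimes>\<^bsub>G\<^esub> inv\<^bsub>G\<^esub> h = k" "(k \<otimes>\<^bsub>G\<^esub> inv\<^bsub>G\<^esub> h) \<otimes>\<^bsub>G\<^esub> h = k"
    if "k \<in> carrier G" for k
    using that h by (simp_all add: G.m_assoc)
  have f: "?f k \<in> A k" if "k \<in> carrier G" for k
    using component_mult[OF _ h component_in[OF x] r, of "k \<otimes>\<^bsub>G\<^esub> inv\<^bsub>G\<^esub> h"] h that cancel(2)[OF that]
    by auto
  have f_closed: "?f k \<in> carrier R" if "k \<in> carrier G" for k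
    using homogeneous_closed[OF that f[OF that]] .
  have "x \<otimes> r = (\<Oplus>k\<in>?S. component x k) \<otimes> r"
    using sum_components[OF x S(1) _ S(2)] by (metis subset_insertI)
  also have "\<dots> = (\<Oplus>k\<in>?S. component x k \<otimes> r)"
    using S rc component_closed[OF x] by (intro R.finsum_ldistr) auto
  also have "\<dots> = (\<Oplus>k\<in>?S. ?f (?t k))"
    using S rc component_closed[OF x] cancel(1) by (intro R.finsum_cong') auto
  also have "\<dots> = (\<Oplus>k\<in>?t ` ?S. ?f k)"
    using S f_closed h
    by (intro R.add.finprod_reindex[symmetric] inj_on_subset[OF G.inj_on_multc]) auto
  finally have "x \<otimes> r = (\<Oplus>k\<in>?t ` ?S. ?f k)" .
  moreover have "g \<in> ?t ` ?S"
    using cancel(2)[OF g] by force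
  moreover have "finite (?t ` ?S)" "?t ` ?S \<subseteq> carrier G"
    using S h by auto
  ultimately show ?thesis
    using component_finsum[of "?t ` ?S" ?f g] f g by auto
qed

text \<open>
  Comparing the components of degree \<open>g\<close> in \<open>a = a \<one>\<close> shows that the neutral component of \<open>\<one>\<close> is
  a right identity for homogeneous elements.
\<close>

lemma homogeneous_mult_component_one:
  assumes g: "g \<in> carrier G" and a: "a \<in> A g"
  shows "a \<otimes> component \<one> \<one>\<^bsub>G\<^esub> = a"
  using component_mult_left[OF g a R.one_closed g] component_homogeneous[OF g a]
    homogeneous_closed[OF g a] g by simp

end

section \<open>Minimal supports in a strongly graded ring\<close>

lemma (in ring) mult_ideal_prod_eq_zero:
  assumes "s \<in> ideal_prod R S T" "S \<subseteq> carrier R" "T \<subseteq> carrier R" "a \<in> carrier R"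
    and "\<And>r. r \<in> S \<Longrightarrow> a \<otimes> r = \<zero>"
  shows "s \<in> carrier R \<and> a \<otimes> s = \<zero>"
  using assms(1)
proof (induction rule: ideal_prod.induct)
  case (prod i j)
  then have "i \<in> carrier R" "j \<in> carrier R"
    using assms by auto
  then show ?case
    using assms(4) assms(5)[OF prod(1)] by (simp add: m_assoc[symmetric])
next
  case (sum s1 s2)
  then show ?case
    using assms(4) by (simp add: r_distr)
qed

context strongly_graded_ring
begin

text \<open>
  The neutral component of \<open>\<one>\<close> is a sum of products \<open>r s\<close> with \<open>r\<close> of degree \<open>g\<inverse>\<close> and \<open>s\<close> of degree
  \<open>g\<close>.  Were \<open>a r = \<zero>\<close> for all these \<open>r\<close>, then \<open>a\<close> would be annihilated by an element that fixes it.
\<close>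

lemma homogeneous_multiplier:
  assumes g: "g \<in> carrier G" and a: "a \<in> A g" "a \<noteq> \<zero>"
  obtains r where "r \<in> A (inv\<^bsub>G\<^esub> g)" "a \<otimes> r \<noteq> \<zero>"
proof -
  have "component \<one> \<one>\<^bsub>G\<^esub> \<in> ideal_prod R (A (inv\<^bsub>G\<^esub> g)) (A g)"
    using component_in[OF R.one_closed G.one_closed] component_prod[of "inv\<^bsub>G\<^esub> g" g] g by simp
  then have "\<exists>r\<in>A (inv\<^bsub>G\<^esub> g). a \<otimes> r \<noteq> \<zero>"
    using R.mult_ideal_prod_eq_zero[of "component \<one> \<one>\<^bsub>G\<^esub>" "A (inv\<^bsub>G\<^esub> g)" "A g" a]
      homogeneous_mult_component_one[OF g a(1)] a homogeneous_closed g
    by (metis G.inv_closed subsetI)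
  then show ?thesis
    using that by blast
qed

text \<open>
  The minimal-support argument: \<open>x\<close> has minimal support, \<open>y = x r\<close> has in addition a nonzero neutral
  component, and the commutators of \<open>y\<close> with the center lose that component.
\<close>

lemma ideal_meets_commutant:
  assumes I: "ideal I R" "I \<noteq> {\<zero>}"
  obtains y where "y \<in> I" "y \<noteq> \<zero>" "y \<in> commutant R (ring_center (R\<lparr>carrier := A \<one>\<^bsub>G\<^esub>\<rparr>))"
proof -
  interpret I: ideal I R by (rule I(1))
  have "\<exists>x. x \<in> I \<and> x \<noteq> \<zero>"
    using I(2) I.zero_closed by blast
  then obtain x where x: "x \<in> I" "x \<noteq> \<zero>"
    and min: "\<And>y. y \<in> I \<and> y \<noteq> \<zero> \<Longrightarrow> card (support x) \<le> card (support y)"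
    using exists_least_iff[of "\<lambda>n. \<exists>x. (x \<in> I \<and> x \<noteq> \<zero>) \<and> n = card (support x)"]
    by (metis linorder_le_less_linear)
  have xc: "x \<in> carrier R"
    using x I.Icarr by blast
  obtain g where g: "g \<in> carrier G" "component x g \<noteq> \<zero>"
    using support_nonempty[OF xc x(2)] by (auto simp: support_def)
  obtain r where r: "r \<in> A (inv\<^bsub>G\<^esub> g)" "component x g \<otimes> r \<noteq> \<zero>"
    using homogeneous_multiplier g component_in[OF xc] by metis
  have rc: "r \<in> carrier R"
    using r g homogeneous_closed by blast
  define y where "y = x \<otimes> r"
  have yI: "y \<in> I"
    unfolding y_def using x rc I.I_r_closed by blast
  then have yc: "y \<in> carrier R"
    using I.Icarr by blast
  have comp_y: "component y k = component x (k \<otimes>\<^bsub>G\<^esub> g) \<otimes> r" if "k \<in> carrier G" for k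
    unfolding y_def using component_mult_right[OF _ r(1) xc that] g by simp
  have y_e: "component y \<one>\<^bsub>G\<^esub> \<noteq> \<zero>"
    using comp_y g r by simp
  then have y0: "y \<noteq> \<zero>"
    using component_zero by auto
  have "(\<lambda>k. k \<otimes>\<^bsub>G\<^esub> g) ` support y \<subseteq> support x"
    using g rc comp_y by (auto simp: support_def)
  moreover have "inj_on (\<lambda>k. k \<otimes>\<^bsub>G\<^esub> g) (support y)"
    using g support_subset by (intro inj_on_subset[OF G.inj_on_multc])
  ultimately have card_y: "card (support y) \<le> card (support x)"
    using finite_support[OF xc] by (metis card_inj_on_le)
  have "y \<otimes> z = z \<otimes> y" if z: "z \<in> ring_center (R\<lparr>carrier := A \<one>\<^bsub>G\<^esub>\<rparr>)" for z
  proof -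
    have zA: "z \<in> A \<one>\<^bsub>G\<^esub>" and z_comm: "\<And>s. s \<in> A \<one>\<^bsub>G\<^esub> \<Longrightarrow> z \<otimes> s = s \<otimes> z"
      using z by (auto simp: ring_center_def commutant_def)
    have zc: "z \<in> carrier R"
      using zA homogeneous_closed by blast
    define w where "w = z \<otimes> y \<ominus> y \<otimes> z"
    have wI: "w \<in> I"
      unfolding w_def using yI zc I.I_l_closed I.I_r_closed
      by (simp add: R.minus_eq)
    have wc: "component w k = \<zero>"
      if "k \<in> carrier G" "z \<otimes> component y k = component y k \<otimes> z" for k
      unfolding w_def
      using that component_mult_left[OF _ zA yc, of k] component_mult_right[OF _ zA yc, of k] yc zc
      by (intro component_diff_eq_zero) auto
    have "support w \<subseteq> support y - {\<one>\<^bsub>G\<^esub>}"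
      using wc zc z_comm[OF component_in[OF yc G.one_closed]] by (auto simp: support_def)
    moreover have "\<one>\<^bsub>G\<^esub> \<in> support y"
      using y_e by (simp add: support_def)
    ultimately have "support w \<subset> support y"
      by blast
    then have "card (support w) < card (support x)"
      using psubset_card_mono[OF finite_support[OF yc]] card_y less_le_trans by blast
    then have "w = \<zero>"
      using min[of w] wI by linarith
    then show ?thesis
      unfolding w_def using yc zc by (simp add: R.r_right_minus_eq)
  qed
  then have "y \<in> commutant R (ring_center (R\<lparr>carrier := A \<one>\<^bsub>G\<^esub>\<rparr>))"
    using yc by (auto simp: commutant_def)
  then show ?thesis
    using that yI y0 by blast
qed

end

theorem theorem3p1:
  fixes G :: "('g, 'a) monoid_scheme" and R :: "('r, 'b) ring_scheme"
    and A :: "'g \<Rightarrow> 'r set"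
  assumes "strongly_graded_ring G R A"
  shows "\<forall>I. ideal I R \<and> I \<noteq> {\<zero>\<^bsub>R\<^esub>} \<longrightarrow>
    I \<inter> commutant R (ring_center (R\<lparr>carrier := A \<one>\<^bsub>G\<^esub>\<rparr>)) \<noteq> {\<zero>\<^bsub>R\<^esub>}"
  using strongly_graded_ring.ideal_meets_commutant[OF assms] by blast

end
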